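(* For every even integer $m\geq 4$ and every integer $k\geq 2$, there exists a $k$-chromatic $P_m$ system (of some order $n>1$).
   Context: $P_m=(a_1,\ldots,a_m)$ denotes the path on $m$ distinct vertices $a_1,\ldots,a_m$ with edges $\{a_i,a_{i+1}\}$, $1\leq i\leq m-1$. A $P_m$ system of order $n>1$ is a pair $(V,\mathcal B)$ where $V$ is a set of $n$ vertices and $\mathcal B$ is a set of $P_m$ paths with vertices in $V$ whose edge sets partition the edge set of the complete graph on $V$. A $k$-colouring of $(V,\mathcal B)$ is a partition of $V$ into $k$ (possibly empty) colour classes such that no path in $\mathcal B$ is monochromatic (i.e. has all its vertices in the same class). The system is $k$-colourable if it has a $k$-colouring, and $k$-chromatic if it is $k$-colourable but not $(k-1)$-colourable. *)

theory Defs
  imports Main "HOL-Library.Disjoint_Sets"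
begin

text \<open>
  A path is represented by the list of its vertices, so each undirected path is
  given by either of two mutually reverse lists.
\<close>

definition is_path :: "nat \<Rightarrow> 'a list \<Rightarrow> bool" where
  "is_path m p \<longleftrightarrow> length p = m \<and> distinct p"

definition path_edges :: "'a list \<Rightarrow> 'a set set" where
  "path_edges p = {{p ! i, p ! Suc i} | i. Suc i < length p}"

definition complete_edges :: "'a set \<Rightarrow> 'a set set" where
  "complete_edges V = {{u, v} | u v. u \<in> V \<and> v \<in> V \<and> u \<noteq> v}"

text \<open>
  The edge sets are required to be disjoint as a family indexed by the paths. For
  \<open>m \<ge> 2\<close> this implies in particular that at most one of the two lists representing
  the same undirected path lies in \<open>B\<close>, so \<open>B\<close> amounts to a set of undirected paths.
\<close>

definition path_system :: "nat \<Rightarrow> nat \<Rightarrow> 'a set \<Rightarrow> 'a list set \<Rightarrow> bool" where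
  "path_system m n V B \<longleftrightarrow>
     n > 1 \<and> finite V \<and> card V = n \<and>
     (\<forall>p\<in>B. is_path m p \<and> set p \<subseteq> V) \<and>
     disjoint_family_on path_edges B \<and>
     (\<Union>p\<in>B. path_edges p) = complete_edges V"

text \<open>
  The colour classes are an indexed family rather than a set of sets, since several
  of them may be empty.
\<close>

definition colouring :: "nat \<Rightarrow> 'a set \<Rightarrow> 'a list set \<Rightarrow> (nat \<Rightarrow> 'a set) \<Rightarrow> bool" where
  "colouring k V B C \<longleftrightarrow>
     disjoint_family_on C {..<k} \<and> (\<Union>i<k. C i) = V \<and>
     (\<forall>p\<in>B. \<not> (\<exists>i<k. set p \<subseteq> C i))"

definition colourable :: "nat \<Rightarrow> 'a set \<Rightarrow> 'a list set \<Rightarrow> bool" where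
  "colourable k V B \<longleftrightarrow> (\<exists>C. colouring k V B C)"

text \<open>Intended for \<open>k \<ge> 1\<close>, as the subtraction is truncated.\<close>

definition chromatic :: "nat \<Rightarrow> 'a set \<Rightarrow> 'a list set \<Rightarrow> bool" where
  "chromatic k V B \<longleftrightarrow> colourable k V B \<and> \<not> colourable (k - 1) V B"

end

theory Submission
  imports Defs "HOL-Library.FuncSet" "HOL-Combinatorics.Transposition"
begin

text \<open>
  Write \<open>m = 2 r\<close> and \<open>M = m - 1\<close>. By induction on the number of colours there is a set of
  edge-disjoint paths on some \<open>U\<close> that is properly coloured by \<open>f\<close> with \<open>k\<close> colours but has no
  proper colouring with \<open>k - 1\<close>: take a large set of new vertices, all of a new colour, and join
  its subsets of a fixed size to \<open>r\<close> copies each of the previous system by alternating paths;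
  this is where \<open>m\<close> has to be even.

  To complete such a set of paths to a path system with the same chromatic number, replace each
  vertex by a group of \<open>M\<close> vertices and add one point at infinity. A group with the point at
  infinity is a \<open>K\<^sub>m\<close>, hence a union of Hamiltonian paths; two groups span a \<open>K\<^sub>M\<^sub>,\<^sub>M\<close>, which
  is decomposed cyclically if the two vertices are not adjacent, and by lifts of the given paths
  otherwise. In the group of \<open>u\<close> one vertex is coloured differently from \<open>f u\<close>, and all others
  are coloured \<open>f u\<close>; the decompositions are chosen so that the exceptional vertices prevent
  every monochromatic path.
\<close>

section \<open>Paths, their edges and injective relabelling of vertices\<close>

definition monochromatic :: "('a \<Rightarrow> nat) \<Rightarrow> 'a list \<Rightarrow> bool" where
  "monochromatic g p \<longleftrightarrow> (\<exists>c. \<forall>v\<in>set p. g v = c)"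

definition packing :: "nat \<Rightarrow> 'a set \<Rightarrow> 'a list set \<Rightarrow> bool" where
  "packing m U B \<longleftrightarrow> (\<forall>p\<in>B. is_path m p \<and> set p \<subseteq> U) \<and> disjoint_family_on path_edges B"

lemma monochromaticI: "(\<And>v. v \<in> set p \<Longrightarrow> g v = c) \<Longrightarrow> monochromatic g p"
  unfolding monochromatic_def by blast

lemma not_monochromaticI:
  "v \<in> set p \<Longrightarrow> w \<in> set p \<Longrightarrow> g v \<noteq> g w \<Longrightarrow> \<not> monochromatic g p"
  unfolding monochromatic_def by metis

lemma monochromatic_map: "monochromatic g (map h p) \<longleftrightarrow> monochromatic (g \<circ> h) p"
  unfolding monochromatic_def by simp

lemma path_edges_map: "path_edges (map h p) = image h ` path_edges p"
  unfolding path_edges_def by (auto simp: image_iff) (metis Suc_lessD image_empty image_insert nth_map)+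

lemma path_edgesE:
  assumes "e \<in> path_edges p"
  obtains i where "Suc i < length p" "e = {p ! i, p ! Suc i}"
  using assms unfolding path_edges_def by blast

lemma path_edgesI: "Suc i < length p \<Longrightarrow> e = {p ! i, p ! Suc i} \<Longrightarrow> e \<in> path_edges p"
  unfolding path_edges_def by blast

lemma path_edges_subset: "e \<in> path_edges p \<Longrightarrow> e \<subseteq> set p"
  by (auto elim!: path_edgesE)

lemma path_edges_subset_complete_edges:
  assumes "distinct p" "set p \<subseteq> V"
  shows "path_edges p \<subseteq> complete_edges V"
proof
  fix e assume "e \<in> path_edges p"
  then obtain i where i: "Suc i < length p" "e = {p ! i, p ! Suc i}"
    by (rule path_edgesE)
  then have "p ! i \<noteq> p ! Suc i"
    using assms(1) by (simp add: nth_eq_iff_index_eq)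
  moreover have "p ! i \<in> V" "p ! Suc i \<in> V"
    using i(1) assms(2) by (auto simp: subset_iff)
  ultimately show "e \<in> complete_edges V"
    unfolding complete_edges_def using i(2) by blast
qed

lemma path_edges_nth_cong:
  assumes "distinct p" "Suc i < length p" "Suc j < length p"
    "{p ! i, p ! Suc i} = {p ! j, p ! Suc j}"
  shows "i = j"
  using assms by (auto simp: doubleton_eq_iff nth_eq_iff_index_eq)

lemma disjoint_family_on_imageI:
  assumes "\<And>i j e. i \<in> I \<Longrightarrow> j \<in> I \<Longrightarrow> e \<in> path_edges (P i) \<Longrightarrow> e \<in> path_edges (P j) \<Longrightarrow> P i = P j"
  shows "disjoint_family_on path_edges (P ` I)"
  unfolding disjoint_family_on_def using assms by blast

lemma disjoint_family_onE:
  assumes "disjoint_family_on A I" "i \<in> I" "j \<in> I" "x \<in> A i" "x \<in> A j"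
  shows "i = j"
  using assms unfolding disjoint_family_on_def by blast

lemma packing_map:
  assumes "inj_on h U" "packing m U B"
  shows "packing m (h ` U) (map h ` B)"
  unfolding packing_def
proof (intro conjI ballI)
  have B: "is_path m p" "set p \<subseteq> U" if "p \<in> B" for p
    using assms(2) that unfolding packing_def by auto
  fix p assume "p \<in> map h ` B"
  then obtain q where q: "q \<in> B" "p = map h q"
    by blast
  then show "is_path m p"
    using B[OF q(1)] inj_on_subset[OF assms(1)] unfolding is_path_def by (simp add: distinct_map)
  show "set p \<subseteq> h ` U"
    using B(2)[OF q(1)] unfolding q(2) by auto
next
  have B: "set p \<subseteq> U" if "p \<in> B" for p
    using assms(2) that unfolding packing_def by auto
  show "disjoint_family_on path_edges (map h ` B)"
  proof (rule disjoint_family_on_imageI)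
    fix p q e assume *: "p \<in> B" "q \<in> B" "e \<in> path_edges (map h p)" "e \<in> path_edges (map h q)"
    then obtain d d' where d: "d \<in> path_edges p" "d' \<in> path_edges q" "h ` d = h ` d'"
      by (auto simp: path_edges_map)
    then have "d \<subseteq> U" "d' \<subseteq> U"
      using B * path_edges_subset by blast+
    then have "d = d'"
      using d(3) assms(1) inj_on_image_eq_iff by metis
    then show "map h p = map h q"
      using d * assms(2) unfolding packing_def by (metis disjoint_family_onE)
  qed
qed

lemma path_system_map:
  assumes "inj_on h V" "path_system m n V B"
  shows "path_system m n (h ` V) (map h ` B)"
proof -
  have "packing m V B"
    using assms(2) unfolding path_system_def packing_def by blast
  then have "packing m (h ` V) (map h ` B)"
    using assms(1) packing_map by blast
  moreover have "complete_edges (h ` V) = image h ` complete_edges V"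
  proof (intro equalityI subsetI)
    fix e assume "e \<in> complete_edges (h ` V)"
    then obtain u v where "u \<in> V" "v \<in> V" "e = {h u, h v}" "h u \<noteq> h v"
      unfolding complete_edges_def by blast
    then have "e = h ` {u, v}" "{u, v} \<in> complete_edges V"
      unfolding complete_edges_def by auto
    then show "e \<in> image h ` complete_edges V"
      by blast
  next
    fix e assume "e \<in> image h ` complete_edges V"
    then obtain u v where "u \<in> V" "v \<in> V" "u \<noteq> v" "e = {h u, h v}"
      unfolding complete_edges_def by auto
    then show "e \<in> complete_edges (h ` V)"
      using assms(1) unfolding complete_edges_def by (auto dest: inj_onD)
  qed
  moreover have "(\<Union>p\<in>map h ` B. path_edges p) = image h ` (\<Union>p\<in>B. path_edges p)"
    by (auto simp: path_edges_map)
  ultimately show ?thesis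
    using assms unfolding path_system_def packing_def by (auto simp: card_image)
qed

section \<open>Colourings as functions on the vertices\<close>

lemma colourable_iff:
  assumes "\<And>p. p \<in> B \<Longrightarrow> set p \<subseteq> V \<and> p \<noteq> []"
  shows "colourable k V B \<longleftrightarrow> (\<exists>g. (\<forall>v\<in>V. g v < k) \<and> (\<forall>p\<in>B. \<not> monochromatic g p))"
proof
  assume "colourable k V B"
  then obtain C where C: "disjoint_family_on C {..<k}" "(\<Union>i<k. C i) = V"
    "\<forall>p\<in>B. \<not> (\<exists>i<k. set p \<subseteq> C i)"
    unfolding colourable_def colouring_def by blast
  then have "\<forall>v\<in>V. \<exists>i. i < k \<and> v \<in> C i"
    by blast
  then obtain g where g: "\<forall>v\<in>V. g v < k \<and> v \<in> C (g v)"
    by metis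
  have "\<not> monochromatic g p" if p: "p \<in> B" for p
  proof
    assume "monochromatic g p"
    then obtain c where c: "\<forall>v\<in>set p. g v = c"
      unfolding monochromatic_def by blast
    \<comment> \<open>The empty list would be monochromatic in every colour. Nonemptiness supplies a
      vertex of \<open>p\<close>, whose colour is the common one and is therefore below
      \<open>k\<close>.\<close>
    have V: "set p \<subseteq> V" and hd: "hd p \<in> set p"
      using assms[OF p] by auto
    then have "hd p \<in> V" "g (hd p) = c"
      using c by auto
    then have "c < k"
      using g by blast
    moreover have "set p \<subseteq> C c"
    proof
      fix v assume "v \<in> set p"
      then have "v \<in> C (g v)" "g v = c"
        using V c g by blast+
      then show "v \<in> C c"
        by simp
    qed
    ultimately show False
      using C(3) p by blast
  qed
  then show "\<exists>g. (\<forall>v\<in>V. g v < k) \<and> (\<forall>p\<in>B. \<not> monochromatic g p)"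
    using g by blast
next
  assume "\<exists>g. (\<forall>v\<in>V. g v < k) \<and> (\<forall>p\<in>B. \<not> monochromatic g p)"
  then obtain g where g: "\<forall>v\<in>V. g v < k" "\<forall>p\<in>B. \<not> monochromatic g p"
    by blast
  have "colouring k V B (\<lambda>i. {v \<in> V. g v = i})"
    unfolding colouring_def
  proof (intro conjI ballI notI)
    show "disjoint_family_on (\<lambda>i. {v \<in> V. g v = i}) {..<k}"
      unfolding disjoint_family_on_def by auto
    show "(\<Union>i<k. {v \<in> V. g v = i}) = V"
      using g(1) by auto
    fix p assume "p \<in> B" "\<exists>i<k. set p \<subseteq> {v \<in> V. g v = i}"
    then show False
      using g(2) monochromaticI[of p g] by blast
  qed
  then show "colourable k V B"
    unfolding colourable_def by blast
qed

lemma colourable_map_iff: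
  assumes "inj_on h V" "\<And>p. p \<in> B \<Longrightarrow> set p \<subseteq> V \<and> p \<noteq> []"
  shows "colourable k (h ` V) (map h ` B) \<longleftrightarrow> colourable k V B"
proof -
  have "set p \<subseteq> h ` V \<and> p \<noteq> []" if "p \<in> map h ` B" for p
    using that assms(2) by fastforce
  note iff = colourable_iff[of "map h ` B" "h ` V" k, OF this] colourable_iff[of B V k, OF assms(2)]
  show ?thesis
  proof
    assume "colourable k (h ` V) (map h ` B)"
    then obtain g where "\<forall>v\<in>h ` V. g v < k" "\<forall>p\<in>map h ` B. \<not> monochromatic g p"
      using iff(1) by blast
    then have "\<forall>v\<in>V. (g \<circ> h) v < k" "\<forall>p\<in>B. \<not> monochromatic (g \<circ> h) p"
      by (auto simp: monochromatic_map)
    then show "colourable k V B"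
      using iff(2) by blast
  next
    assume "colourable k V B"
    then obtain g where g: "\<forall>v\<in>V. g v < k" "\<forall>p\<in>B. \<not> monochromatic g p"
      using iff(2) by blast
    define g' where "g' = g \<circ> the_inv_into V h"
    have eq: "g' (h v) = g v" if "v \<in> V" for v
      using that assms(1) by (simp add: g'_def the_inv_into_f_f)
    have "\<not> monochromatic g' (map h p)" if "p \<in> B" for p
      using g(2) that eq assms(2)[OF that] unfolding monochromatic_def by (auto simp: subset_iff)
    moreover have "\<forall>v\<in>h ` V. g' v < k"
      using eq g(1) by auto
    ultimately show "colourable k (h ` V) (map h ` B)"
      using iff(1) by blast
  qed
qed

text \<open>The constructions below produce vertices in product and \<open>option\<close> types. A
  path system has finitely many vertices, so they can be renamed by natural numbers at the
  end.\<close>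

lemma chromatic_path_system_nat:
  fixes V :: "'a set"
  assumes "path_system m n V B" "m > 0" "chromatic k V B"
  shows "\<exists>n (V :: nat set) B. path_system m n V B \<and> chromatic k V B"
proof -
  have "finite V"
    using assms(1) unfolding path_system_def by blast
  then obtain h :: "'a \<Rightarrow> nat" where h: "inj_on h V"
    using finite_imp_inj_to_nat_seg by metis
  have "set p \<subseteq> V \<and> p \<noteq> []" if "p \<in> B" for p
    using assms(1,2) that unfolding path_system_def is_path_def by auto
  then have "chromatic k (h ` V) (map h ` B)"
    using assms(3) colourable_map_iff[OF h] unfolding chromatic_def by auto
  then show ?thesis
    using path_system_map[OF h assms(1)] by blast
qed

section \<open>Critical packings, by induction on the number of colours\<close>

lemma pigeonhole_colour:
  fixes g :: "'a \<Rightarrow> nat"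
  assumes "finite X" "\<And>x. x \<in> X \<Longrightarrow> g x < k" "card X \<ge> k * L" "k > 0"
  shows "\<exists>c<k. card {x \<in> X. g x = c} \<ge> L"
proof (rule ccontr)
  assume "\<not> (\<exists>c<k. card {x \<in> X. g x = c} \<ge> L)"
  then have less: "card {x \<in> X. g x = c} < L" if "c < k" for c
    using that by (meson not_le)
  have "card X = card (\<Union>c<k. {x \<in> X. g x = c})"
    by (rule arg_cong[where f = card]) (use assms(2) in auto)
  also have "\<dots> \<le> (\<Sum>c<k. card {x \<in> X. g x = c})"
    by (rule card_UN_le) simp
  also have "\<dots> < (\<Sum>c<k. L)"
    by (rule sum_strict_mono) (use less assms(4) in auto)
  finally show False
    using assms(3) by simp
qed

text \<open>
  The condition on the first four vertices of a path is stronger than not being monochromatic; it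
  survives if one of the vertices at positions 0, 2 and one of those at 1, 3 are recoloured.
\<close>

definition critical :: "nat \<Rightarrow> nat \<Rightarrow> 'a set \<Rightarrow> 'a list set \<Rightarrow> ('a \<Rightarrow> nat) \<Rightarrow> bool" where
  "critical m K U B f \<longleftrightarrow> finite U \<and> packing m U B \<and> (\<forall>u\<in>U. f u < Suc K) \<and>
     (\<forall>p\<in>B. f (p ! 0) = f (p ! 2) \<and> f (p ! 1) \<noteq> f (p ! 0) \<and> f (p ! 3) \<noteq> f (p ! 0)) \<and>
     (\<forall>g. (\<forall>u\<in>U. g u < K) \<longrightarrow> (\<exists>p\<in>B. monochromatic g p))"

text \<open>The inductive step enlarges the vertex type while the induction has to stay on a single
  type, hence this transport. The bound \<open>m \<ge> 4\<close> places the four inspected positions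
  inside each path, so that the inverse of \<open>h\<close> is applied only to images of elements of
  \<open>U\<close>.\<close>

lemma critical_map:
  assumes "inj_on h U" "critical m K U B f" "m \<ge> 4"
  shows "critical m K (h ` U) (map h ` B) (f \<circ> the_inv_into U h)"
proof -
  have eq: "(f \<circ> the_inv_into U h) (h u) = f u" if "u \<in> U" for u
    using that assms(1) by (simp add: the_inv_into_f_f)
  have B: "length p = m" "set p \<subseteq> U" if "p \<in> B" for p
    using assms(2) that unfolding critical_def packing_def is_path_def by auto
  have nth: "(f \<circ> the_inv_into U h) (map h p ! i) = f (p ! i)" if "p \<in> B" "i < 4" for p i
  proof -
    have "i < length p"
      using B that assms(3) by simp
    then have "p ! i \<in> U"
      using B(2)[OF that(1)] by (auto simp: subset_iff)
    then show ?thesis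
      using eq \<open>i < length p\<close> by simp
  qed
  show ?thesis
    unfolding critical_def
  proof (intro conjI allI impI)
    fix g assume g: "\<forall>u\<in>h ` U. g u < K"
    then have "\<forall>u\<in>U. (g \<circ> h) u < K"
      by auto
    then obtain p where "p \<in> B" "monochromatic (g \<circ> h) p"
      using assms(2) unfolding critical_def by blast
    then show "\<exists>p\<in>map h ` B. monochromatic g p"
      by (auto simp: monochromatic_map)
  next
    show "packing m (h ` U) (map h ` B)"
      by (rule packing_map[OF assms(1)]) (use assms(2) in \<open>simp add: critical_def\<close>)
  next
    show "\<forall>u\<in>h ` U. (f \<circ> the_inv_into U h) u < Suc K"
      using eq assms(2) unfolding critical_def by simp
  next
    show "\<forall>p\<in>map h ` B. (f \<circ> the_inv_into U h) (p ! 0) = (f \<circ> the_inv_into U h) (p ! 2) \<and>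
      (f \<circ> the_inv_into U h) (p ! 1) \<noteq> (f \<circ> the_inv_into U h) (p ! 0) \<and>
      (f \<circ> the_inv_into U h) (p ! 3) \<noteq> (f \<circ> the_inv_into U h) (p ! 0)"
    proof
      fix q assume "q \<in> map h ` B"
      then obtain p where p: "p \<in> B" "q = map h p"
        by blast
      then have "f (p ! 0) = f (p ! 2) \<and> f (p ! 1) \<noteq> f (p ! 0) \<and> f (p ! 3) \<noteq> f (p ! 0)"
        using assms(2) unfolding critical_def by blast
      then show "(f \<circ> the_inv_into U h) (q ! 0) = (f \<circ> the_inv_into U h) (q ! 2) \<and>
        (f \<circ> the_inv_into U h) (q ! 1) \<noteq> (f \<circ> the_inv_into U h) (q ! 0) \<and>
        (f \<circ> the_inv_into U h) (q ! 3) \<noteq> (f \<circ> the_inv_into U h) (q ! 0)"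
        unfolding p(2) by (simp del: o_apply add: nth[OF p(1)])
    qed
  next
    show "finite (h ` U)"
      using assms(2) unfolding critical_def by simp
  qed
qed

text \<open>
  \<open>Inl x\<close> is a new vertex. \<open>Inr (\<phi>, j, u)\<close> is the vertex \<open>u\<close> in the \<open>j\<close>-th of the copies attached
  to the range of \<open>\<phi>\<close>, where \<open>\<phi>\<close> enumerates the new vertices of a subset by pairs of an
  \<open>r\<close>-tuple of old vertices and an index below \<open>r\<close>.
\<close>

type_synonym 'a amalgam = "nat + ((nat \<Rightarrow> 'a) \<times> nat \<Rightarrow> nat) \<times> nat \<times> 'a"

text \<open>Edge-disjointness holds because an edge reveals its path. An edge of
  \<open>P (\<phi>, \<tau>)\<close> has one new and one old end: the old end carries
  \<open>\<phi>\<close> as a label, and by injectivity of \<open>\<phi>\<close> the new end then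
  determines \<open>\<tau>\<close>. Each alternating path visits \<open>r\<close> new vertices and
  one vertex in each of \<open>r\<close> copies; using different copies keeps the old vertices
  distinct even if \<open>\<tau>\<close> repeats a value.\<close>

lemma critical_step:
  fixes U :: "'a set"
  assumes crit: "critical (2 * r) K U B f" and r: "r \<ge> 2"
  shows "\<exists>(U' :: 'a amalgam set) B' f'.
    critical (2 * r) (Suc K) U' B' f'"
proof -
  have finU: "finite U" and pack: "packing (2 * r) U B" and f: "\<And>u. u \<in> U \<Longrightarrow> f u < Suc K"
    and nm: "\<And>g. \<forall>u\<in>U. g u < K \<Longrightarrow> \<exists>p\<in>B. monochromatic g p"
    and alt: "\<And>p. p \<in> B \<Longrightarrow> f (p ! 0) = f (p ! 2) \<and> f (p ! 1) \<noteq> f (p ! 0) \<and> f (p ! 3) \<noteq> f (p ! 0)"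
    using crit unfolding critical_def by blast+
  have B: "length p = 2 * r" "distinct p" "set p \<subseteq> U" if "p \<in> B" for p
    using pack that unfolding packing_def is_path_def by auto
  \<comment> \<open>A member of \<open>D\<close> selects one vertex from each of the
    \<open>r\<close> copies. Extensional function spaces keep \<open>D\<close> and later
    \<open>\<Phi>\<close> finite.\<close>
  define D where "D = ({..<r} \<rightarrow>\<^sub>E U)"
  define T where "T = D \<times> {..<r}"
  \<comment> \<open>The size is chosen for the pigeonhole principle: any colouring of
    \<open>X\<close> with \<open>Suc K\<close> colours has a class large enough to contain an
    injective image of \<open>T\<close>.\<close>
  define X where "X = {..<Suc K * card T}"
  define \<Phi> where "\<Phi> = {\<phi> \<in> T \<rightarrow>\<^sub>E X. inj_on \<phi> T}"
  have finD: "finite D"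
    unfolding D_def using finU by (simp add: finite_PiE)
  then have finT: "finite T"
    unfolding T_def by simp
  have fin\<Phi>: "finite \<Phi>"
    unfolding \<Phi>_def X_def using finT by (simp add: finite_PiE)
  define U' where "U' = Inl ` X \<union> Inr ` (\<Phi> \<times> {..<r} \<times> U)"
  define P where "P = (\<lambda>(\<phi>, \<tau>). map (\<lambda>j. if even j then Inl (\<phi> (\<tau>, j div 2)) :: 'a amalgam
      else Inr (\<phi>, j div 2, \<tau> (j div 2))) [0..<2 * r])"
  define Q where "Q = (\<lambda>(\<phi>, j, p). map (\<lambda>u. Inr (\<phi>, j, u) :: 'a amalgam) p)"
  \<comment> \<open>Old colours are below \<open>Suc K\<close>, so along each \<open>P\<close> the
    colour \<open>Suc K\<close> alternates with smaller ones, as the condition on positions 0 to 3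
    requires. Along each \<open>Q\<close> that condition is inherited from \<open>f\<close>.\<close>
  define f' :: "'a amalgam \<Rightarrow> nat" where "f' = case_sum (\<lambda>_. Suc K) (\<lambda>(\<phi>, j, u). f u)"
  define B' where "B' = P ` (\<Phi> \<times> D) \<union> Q ` (\<Phi> \<times> {..<r} \<times> B)"
  have edgeP: "\<exists>a<r. \<exists>b<r. e = {Inl (\<phi> (\<tau>, a)), Inr (\<phi>, b, \<tau> b)}"
    if "e \<in> path_edges (P (\<phi>, \<tau>))" for e \<phi> \<tau>
  proof -
    from that obtain i where i: "Suc i < 2 * r" "e = {P (\<phi>, \<tau>) ! i, P (\<phi>, \<tau>) ! Suc i}"
      by (auto simp: P_def elim: path_edgesE)
    \<comment> \<open>One formula serves both parities of \<open>i\<close>: the new end always has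
      index \<open>Suc i div 2\<close> and the old end \<open>i div 2\<close>.\<close>
    then have "e = {Inl (\<phi> (\<tau>, Suc i div 2)), Inr (\<phi>, i div 2, \<tau> (i div 2))}"
      by (cases "even i") (auto simp: P_def)
    moreover have "Suc i div 2 < r" "i div 2 < r"
      using i(1) by auto
    ultimately show ?thesis
      by blast
  qed
  have edgeQ: "\<exists>d\<in>path_edges p. e = (\<lambda>u. Inr (\<phi>, j, u)) ` d"
    if "e \<in> path_edges (Q (\<phi>, j, p))" for e \<phi> j p
    using that by (auto simp: Q_def path_edges_map)
  have edge_ne: "d \<noteq> {}" if "d \<in> path_edges p" for d :: "'a set" and p
    using that by (auto elim: path_edgesE)
  have inj\<Phi>: "\<tau> = \<tau>' \<and> a = a'"
    if "\<phi> \<in> \<Phi>" "\<tau> \<in> D" "\<tau>' \<in> D" "a < r" "a' < r" "\<phi> (\<tau>, a) = \<phi> (\<tau>', a')" for \<phi> \<tau> \<tau>' a a'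
    using that unfolding \<Phi>_def T_def by (auto dest: inj_onD)
  have "packing (2 * r) U' B'"
    unfolding packing_def
  proof (intro conjI ballI)
    fix p assume "p \<in> B'"
    then consider (P) \<phi> \<tau> where "\<phi> \<in> \<Phi>" "\<tau> \<in> D" "p = P (\<phi>, \<tau>)"
      | (Q) \<phi> j q where "\<phi> \<in> \<Phi>" "j < r" "q \<in> B" "p = Q (\<phi>, j, q)"
      unfolding B'_def by auto
    then have "is_path (2 * r) p \<and> set p \<subseteq> U'"
    proof cases
      case P
      have "inj_on (\<lambda>j. if even j then Inl (\<phi> (\<tau>, j div 2))
        else Inr (\<phi>, j div 2, \<tau> (j div 2))) {..<2 * r}"
      proof (rule inj_onI)
        fix i j assume ij: "i \<in> {..<2 * r}" "j \<in> {..<2 * r}"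
          "(if even i then Inl (\<phi> (\<tau>, i div 2)) :: 'a amalgam else Inr (\<phi>, i div 2, \<tau> (i div 2))) =
            (if even j then Inl (\<phi> (\<tau>, j div 2)) else Inr (\<phi>, j div 2, \<tau> (j div 2)))"
        then have "even i = even j" "i div 2 = j div 2"
          using inj\<Phi>[OF P(1,2,2), of "i div 2" "j div 2"] by (auto split: if_splits)
        then show "i = j"
          by presburger
      qed
      then have "is_path (2 * r) p"
        unfolding is_path_def P(3) P_def by (simp add: distinct_map atLeast0LessThan)
      moreover have "\<phi> (\<tau>, j div 2) \<in> X" "\<tau> (j div 2) \<in> U" if "j < 2 * r" for j
        using P(1,2) that unfolding \<Phi>_def T_def D_def by auto
      then have "set p \<subseteq> U'"
        unfolding P(3) P_def U'_def using P(1) by auto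
      ultimately show ?thesis ..
    next
      case Q
      then show ?thesis
        using B[OF Q(3)] unfolding is_path_def Q_def U'_def
        by (auto simp: distinct_map inj_on_def)
    qed
    then show "is_path (2 * r) p" "set p \<subseteq> U'"
      by auto
  next
    show "disjoint_family_on path_edges B'"
      unfolding disjoint_family_on_def
    proof (intro ballI impI)
      fix p q assume pq: "p \<in> B'" "q \<in> B'" "p \<noteq> q"
      have PQ: False if "e \<in> path_edges (P (\<phi>, \<tau>))" "e \<in> path_edges (Q (\<phi>', j, x))" for e \<phi> \<tau> \<phi>' j x
        using edgeP[OF that(1)] edgeQ[OF that(2)] by (auto simp: set_eq_iff)
      have PP: "(\<phi>, \<tau>) = (\<phi>', \<tau>')" if "e \<in> path_edges (P (\<phi>, \<tau>))" "e \<in> path_edges (P (\<phi>', \<tau>'))"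
        "\<phi> \<in> \<Phi>" "\<phi>' \<in> \<Phi>" "\<tau> \<in> D" "\<tau>' \<in> D" for e \<phi> \<tau> \<phi>' \<tau>'
        using edgeP[OF that(1)] edgeP[OF that(2)] inj\<Phi> that(3-) by (auto simp: doubleton_eq_iff)
      have QQ: "(\<phi>, j, x) = (\<phi>', j', x')"
        if e: "e \<in> path_edges (Q (\<phi>, j, x))" "e \<in> path_edges (Q (\<phi>', j', x'))"
        and x: "x \<in> B" "x' \<in> B" for e \<phi> j x \<phi>' j' x'
      proof -
        obtain d d' where d: "d \<in> path_edges x" "d' \<in> path_edges x'"
          "(\<lambda>u. Inr (\<phi>, j, u) :: 'a amalgam) ` d = (\<lambda>u. Inr (\<phi>', j', u)) ` d'"
          using edgeQ[OF e(1)] edgeQ[OF e(2)] by metis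
        obtain u where "u \<in> d"
          using edge_ne[OF d(1)] by blast
        then have "(Inr (\<phi>, j, u) :: 'a amalgam) \<in> (\<lambda>u. Inr (\<phi>', j', u)) ` d'"
          using d(3) by blast
        then have 1: "\<phi> = \<phi>'" "j = j'"
          by auto
        have "d = d'"
          using d(3) inj_image_eq_iff[of "\<lambda>u. Inr (\<phi>', j', u) :: 'a amalgam"]
          unfolding 1 by (simp add: inj_def)
        then show ?thesis
          using 1 d x pack unfolding packing_def by (metis disjoint_family_onE)
      qed
      show "path_edges p \<inter> path_edges q = {}"
      proof (rule ccontr)
        assume "path_edges p \<inter> path_edges q \<noteq> {}"
        then obtain e where e: "e \<in> path_edges p" "e \<in> path_edges q"
          by blast
        consider \<phi> \<tau> where "\<phi> \<in> \<Phi>" "\<tau> \<in> D" "p = P (\<phi>, \<tau>)"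
          | \<phi> j x where "x \<in> B" "p = Q (\<phi>, j, x)"
          using pq(1) unfolding B'_def by auto
        then show False
        proof cases
          case p: 1
          from pq(2) consider \<phi>' \<tau>' where "\<phi>' \<in> \<Phi>" "\<tau>' \<in> D" "q = P (\<phi>', \<tau>')"
            | \<phi>' j' x' where "q = Q (\<phi>', j', x')"
            unfolding B'_def by auto
          then show False
          proof cases
            case 1
            then show False
              using PP[of e, OF e[unfolded p(3) 1(3)]] p pq(3) by simp
          next
            case 2
            then show False
              using PQ e p(3) by simp
          qed
        next
          case p: 2
          from pq(2) consider \<phi>' \<tau>' where "q = P (\<phi>', \<tau>')"
            | \<phi>' j' x' where "x' \<in> B" "q = Q (\<phi>', j', x')"
            unfolding B'_def by auto
          then show False
          proof cases
            case 1
            then show False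
              using PQ e p(2) by simp
          next
            case 2
            then show False
              using QQ[of e, OF e[unfolded p(2) 2(2)]] p pq(3) by simp
          qed
        qed
      qed
    qed
  qed
  moreover have "finite U'"
    unfolding U'_def X_def using fin\<Phi> finU by simp
  moreover have "\<forall>u\<in>U'. f' u < Suc (Suc K)"
    unfolding U'_def f'_def using f by (auto simp: less_SucI)
  moreover have "\<forall>p\<in>B'. f' (p ! 0) = f' (p ! 2) \<and> f' (p ! 1) \<noteq> f' (p ! 0) \<and> f' (p ! 3) \<noteq> f' (p ! 0)"
  proof
    fix p assume "p \<in> B'"
    then consider (P) \<phi> \<tau> where "\<phi> \<in> \<Phi>" "\<tau> \<in> D" "p = P (\<phi>, \<tau>)"
      | (Q) \<phi> j q where "\<phi> \<in> \<Phi>" "j < r" "q \<in> B" "p = Q (\<phi>, j, q)"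
      unfolding B'_def by auto
    then show "f' (p ! 0) = f' (p ! 2) \<and> f' (p ! 1) \<noteq> f' (p ! 0) \<and> f' (p ! 3) \<noteq> f' (p ! 0)"
    proof cases
      case P
      have "f (\<tau> j) < Suc K" if "j < r" for j
        by (rule f, rule PiE_mem[OF P(2)[unfolded D_def]]) (use that in simp)
      then have "f (\<tau> 0) < Suc K" "f (\<tau> 1) < Suc K"
        using r by simp_all
      then show ?thesis
        using r unfolding P(3) P_def f'_def by simp
    next
      case Q
      then show ?thesis
        using B(1)[OF Q(3)] r alt[OF Q(3)] unfolding Q(4) Q_def f'_def by simp
    qed
  qed
  \<comment> \<open>Some \<open>\<phi>\<close> has all its values of one colour \<open>c\<close>. If \<open>c\<close> occurs in each of its copies, an
    alternating path has colour \<open>c\<close>; otherwise some copy has only the other \<open>K\<close> colours.\<close>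
  moreover have "\<exists>p\<in>B'. monochromatic g p" if g: "\<forall>u\<in>U'. g u < Suc K" for g
  proof -
    have "\<exists>c<Suc K. card {x \<in> X. g (Inl x) = c} \<ge> card T"
      by (rule pigeonhole_colour) (use g in \<open>auto simp: X_def U'_def\<close>)
    then obtain c where c: "c < Suc K" "card T \<le> card {x \<in> X. g (Inl x) = c}"
      by blast
    have "finite {x \<in> X. g (Inl x) = c}"
      by (simp add: X_def)
    then obtain \<phi>0 where \<phi>0: "\<phi>0 ` T \<subseteq> {x \<in> X. g (Inl x) = c}" "inj_on \<phi>0 T"
      using card_le_inj[OF finT] c(2) by blast
    \<comment> \<open>Restriction makes the injection extensional, as membership in
      \<open>\<Phi>\<close> demands.\<close>
    define \<phi> where "\<phi> = restrict \<phi>0 T"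
    have \<phi>: "\<phi> \<in> \<Phi>" "\<And>x. x \<in> T \<Longrightarrow> g (Inl (\<phi> x)) = c"
      using \<phi>0 unfolding \<phi>_def \<Phi>_def by (auto simp: inj_on_def)
    show ?thesis
    proof (cases "\<forall>j<r. \<exists>u\<in>U. g (Inr (\<phi>, j, u)) = c")
      case True
      then obtain \<tau>0 where \<tau>0: "\<And>j. j < r \<Longrightarrow> \<tau>0 j \<in> U \<and> g (Inr (\<phi>, j, \<tau>0 j)) = c"
        by metis
      define \<tau> where "\<tau> = restrict \<tau>0 {..<r}"
      have \<tau>: "\<tau> \<in> D" "\<And>j. j < r \<Longrightarrow> g (Inr (\<phi>, j, \<tau> j)) = c"
        using \<tau>0 unfolding \<tau>_def D_def by auto
      have "monochromatic g (P (\<phi>, \<tau>))"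
        by (rule monochromaticI[where c = c])
          (use \<tau> \<phi>(2) in \<open>auto simp: P_def T_def split: if_splits\<close>)
      then show ?thesis
        using \<phi>(1) \<tau>(1) unfolding B'_def by blast
    next
      case False
      then obtain j where j: "j < r" "\<And>u. u \<in> U \<Longrightarrow> g (Inr (\<phi>, j, u)) \<noteq> c"
        by blast
      \<comment> \<open>Colour \<open>c\<close> is absent from this copy. Lowering the colours above
        \<open>c\<close> by one closes the gap and leaves a colouring with \<open>K\<close> colours;
        the shift is undone below to return to \<open>g\<close>.\<close>
      define g' where "g' u = (let v = g (Inr (\<phi>, j, u)) in if v < c then v else v - 1)" for u
      have g_less: "g (Inr (\<phi>, j, u)) < Suc K" if "u \<in> U" for u
        using g that \<phi>(1) j(1) unfolding U'_def by blast
      have "g' u < K" if "u \<in> U" for u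
        using j(2)[OF that] g_less[OF that] c(1) unfolding g'_def Let_def by auto
      then obtain p where p: "p \<in> B" "monochromatic g' p"
        using nm by blast
      then obtain d where d: "\<And>u. u \<in> set p \<Longrightarrow> g' u = d"
        unfolding monochromatic_def by blast
      have "g (Inr (\<phi>, j, u)) = (if d < c then d else Suc d)" if "u \<in> set p" for u
      proof -
        have "u \<in> U"
          using B(3)[OF p(1)] that by blast
        then show ?thesis
          using j(2)[of u] d[OF that] unfolding g'_def Let_def by (auto split: if_splits)
      qed
      then have "monochromatic g (Q (\<phi>, j, p))"
        by (intro monochromaticI[where c = "if d < c then d else Suc d"]) (auto simp: Q_def)
      then show ?thesis
        using p(1) \<phi>(1) j(1) unfolding B'_def by blast
    qed
  qed
  ultimately have "critical (2 * r) (Suc K) U' B' f'"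
    unfolding critical_def by blast
  then show ?thesis
    by blast
qed

lemma critical_exists:
  assumes "r \<ge> 2"
  shows "\<exists>(U :: nat set) B f. critical (2 * r) K U B f"
proof (induction K)
  case 0
  \<comment> \<open>The vertex set is nonempty, so no \<open>g\<close> has all its values below 0
    and the condition on colourings holds vacuously, without any path.\<close>
  have "critical (2 * r) 0 {0 :: nat} {} (\<lambda>_. 0)"
    unfolding critical_def packing_def disjoint_family_on_def by simp
  then show ?case
    by blast
next
  case (Suc K)
  then obtain U :: "nat set" and B f where "critical (2 * r) K U B f"
    by blast
  from critical_step[OF this assms]
  obtain U' :: "nat amalgam set" and B' f'
    where U': "critical (2 * r) (Suc K) U' B' f'"
    by blast
  then have "finite U'"
    unfolding critical_def by blast
  then obtain h :: "_ \<Rightarrow> nat" where "inj_on h U'"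
    using finite_imp_inj_to_nat_seg by metis
  then show ?case
    using critical_map[OF _ U'] assms by fastforce
qed

section \<open>Decompositions of edge sets into paths\<close>

text \<open>The predicate \<open>Q\<close> lets a decomposition carry a condition on each of its
  paths. It is used for lying in the vertex set and not being monochromatic.\<close>

definition decomposable :: "nat \<Rightarrow> ('a list \<Rightarrow> bool) \<Rightarrow> 'a set set \<Rightarrow> bool" where
  "decomposable m Q E \<longleftrightarrow> (\<exists>B. (\<forall>p\<in>B. is_path m p \<and> Q p) \<and>
     disjoint_family_on path_edges B \<and> (\<Union>p\<in>B. path_edges p) = E)"

text \<open>It suffices that an edge determines the parameter \<open>t\<close>: a shared edge then
  forces equal paths, and nothing about its position in the path has to be known.\<close>

lemma decomposable_family:
  assumes inj: "\<And>t. t \<in> I \<Longrightarrow> inj_on (\<phi> t) {..<m}"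
    and Q: "\<And>t. t \<in> I \<Longrightarrow> Q (map (\<phi> t) [0..<m])"
    and uniq: "\<And>t t' j j'. \<lbrakk>t \<in> I; t' \<in> I; Suc j < m; Suc j' < m;
      {\<phi> t j, \<phi> t (Suc j)} = {\<phi> t' j', \<phi> t' (Suc j')}\<rbrakk> \<Longrightarrow> t = t'"
    and E: "\<And>e. e \<in> E \<longleftrightarrow> (\<exists>t\<in>I. \<exists>j. Suc j < m \<and> e = {\<phi> t j, \<phi> t (Suc j)})"
  shows "decomposable m Q E"
proof -
  define P where "P t = map (\<phi> t) [0..<m]" for t
  have edges: "path_edges (P t) = {{\<phi> t j, \<phi> t (Suc j)} | j. Suc j < m}" for t
  proof -
    have "P t ! i = \<phi> t i \<and> P t ! Suc i = \<phi> t (Suc i)" if "Suc i < m" for i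
      using that unfolding P_def by simp
    moreover have "length (P t) = m"
      unfolding P_def by simp
    ultimately show ?thesis
      unfolding path_edges_def by metis
  qed
  have "disjoint_family_on path_edges (P ` I)"
    by (rule disjoint_family_on_imageI, rule arg_cong[where f = P])
      (auto simp: edges intro: uniq)
  moreover have "(\<Union>p\<in>P ` I. path_edges p) = E"
  proof (rule set_eqI)
    fix e
    show "e \<in> (\<Union>p\<in>P ` I. path_edges p) \<longleftrightarrow> e \<in> E"
      unfolding E[of e] image_image UN_iff bex_simps edges mem_Collect_eq by metis
  qed
  moreover have "\<forall>p\<in>P ` I. is_path m p \<and> Q p"
    using inj Q unfolding is_path_def P_def by (simp add: distinct_map atLeast0LessThan)
  ultimately show ?thesis
    unfolding decomposable_def by blast
qed

text \<open>A set of edge sets, unlike an indexed family, permits the same edge set to arise twice.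
  In the completion below a pair of groups appears in both orders.\<close>

lemma decomposable_Union:
  assumes "\<And>E. E \<in> \<D> \<Longrightarrow> decomposable m Q E" "disjoint \<D>"
  shows "decomposable m Q (\<Union>\<D>)"
proof -
  have "\<forall>E\<in>\<D>. \<exists>B. (\<forall>p\<in>B. is_path m p \<and> Q p) \<and>
     disjoint_family_on path_edges B \<and> (\<Union>p\<in>B. path_edges p) = E"
    using assms(1) unfolding decomposable_def by blast
  then obtain B where B: "\<And>E p. E \<in> \<D> \<Longrightarrow> p \<in> B E \<Longrightarrow> is_path m p \<and> Q p"
    "\<And>E. E \<in> \<D> \<Longrightarrow> disjoint_family_on path_edges (B E)"
    "\<And>E. E \<in> \<D> \<Longrightarrow> (\<Union>p\<in>B E. path_edges p) = E"
    by metis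
  have "disjoint_family_on path_edges (\<Union>E\<in>\<D>. B E)"
    unfolding disjoint_family_on_def
  proof (intro ballI impI)
    fix p q assume "p \<in> (\<Union>E\<in>\<D>. B E)" "q \<in> (\<Union>E\<in>\<D>. B E)" and "p \<noteq> q"
    then obtain E E' where E: "E \<in> \<D>" "E' \<in> \<D>" "p \<in> B E" "q \<in> B E'"
      by blast
    show "path_edges p \<inter> path_edges q = {}"
    proof (cases "E = E'")
      case True
      then show ?thesis
        using B(2)[OF E(1)] E \<open>p \<noteq> q\<close> unfolding disjoint_family_on_def by blast
    next
      case False
      then have "E \<inter> E' = {}"
        using assms(2) E unfolding disjoint_def by blast
      then show ?thesis
        using B(3)[OF E(1)] B(3)[OF E(2)] E(3,4) by blast
    qed
  qed
  moreover have "(\<Union>p\<in>(\<Union>E\<in>\<D>. B E). path_edges p) = \<Union>\<D>"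
    using B(3) by auto
  moreover have "\<forall>p\<in>(\<Union>E\<in>\<D>. B E). is_path m p \<and> Q p"
    using B(1) by blast
  ultimately show ?thesis
    unfolding decomposable_def by (intro exI[of _ "\<Union>E\<in>\<D>. B E"] conjI)
qed

text \<open>The prescribed paths \<open>L\<close> must survive unchanged, because they will be what
  rules out a colouring with fewer colours.\<close>

lemma decomposable_extend:
  assumes "decomposable m Q E" "\<And>p. p \<in> L \<Longrightarrow> is_path m p \<and> Q p"
    "disjoint_family_on path_edges L" "E \<inter> (\<Union>p\<in>L. path_edges p) = {}"
  shows "\<exists>B. L \<subseteq> B \<and> (\<forall>p\<in>B. is_path m p \<and> Q p) \<and> disjoint_family_on path_edges B \<and>
    (\<Union>p\<in>B. path_edges p) = E \<union> (\<Union>p\<in>L. path_edges p)"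
proof -
  obtain B where B: "\<forall>p\<in>B. is_path m p \<and> Q p" "disjoint_family_on path_edges B"
    "(\<Union>p\<in>B. path_edges p) = E"
    using assms(1) unfolding decomposable_def by blast
  have "disjoint_family_on path_edges (B \<union> L)"
    using B(2,3) assms(3,4) unfolding disjoint_family_on_def by blast
  then show ?thesis
    using B assms(2) by (intro exI[of _ "B \<union> L"]) auto
qed

section \<open>Cyclic decompositions of complete and complete bipartite graphs\<close>

lemma mod_eq_imp_eq_int:
  fixes a b n :: int
  assumes "a mod n = b mod n" "\<bar>a - b\<bar> < n"
  shows "a = b"
  using assms by (metis dvd_imp_le_int eq_iff_diff_eq_0 linorder_not_less mod_eq_dvd_iff abs_of_pos
      abs_ge_zero order_le_less_trans)

text \<open>Walecki's decomposition into \<open>r\<close> Hamiltonian paths: with the vertices taken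
  as residues modulo \<open>2 * r\<close>, the zigzag 0, 1, -1, 2, -2, ..., \<open>r\<close> is
  translated by \<open>t\<close> for \<open>t < r\<close>.\<close>

lemma decomposable_complete_edges:
  assumes card: "finite W" "card W = 2 * r" and Q: "\<And>p. is_path (2 * r) p \<Longrightarrow> set p = W \<Longrightarrow> Q p"
  shows "decomposable (2 * r) Q (complete_edges W)"
proof -
  define n where "n = 2 * int r"
  obtain h where h: "bij_betw h {0..<n} W"
    using finite_same_card_bij[of "{0..<n}" W] card by (auto simp: n_def nat_mult_distrib)
  \<comment> \<open>The edges of the \<open>t\<close>-th zigzag are the pairs whose sum is \<open>2 t\<close> or \<open>2 t + 1\<close> modulo \<open>n\<close>.\<close>
  define pos where "pos j = (if even j then - int (j div 2) else int (Suc j div 2))" for j :: nat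
  define \<phi> where "\<phi> t j = h ((t + pos j) mod n)" for t j
  \<comment> \<open>The positions fit into a half-open interval of length \<open>n\<close>, so
    distinct positions remain distinct modulo \<open>n\<close>.\<close>
  have pos_bound: "- int r < pos j \<and> pos j \<le> int r" if "j < 2 * r" for j
    using that unfolding pos_def by auto
  have pos_eq: "i = j" if "pos i = pos j" for i j
    using that unfolding pos_def by (auto split: if_splits elim!: evenE oddE)
  have pos_sum: "pos j + pos (Suc j) = (if even j then 1 else 0)" for j
    unfolding pos_def by (auto elim!: evenE oddE)
  have h_eq: "x = y" if "h x = h y" "0 \<le> x" "x < n" "0 \<le> y" "y < n" for x y
    using h that unfolding bij_betw_def by (auto dest: inj_onD)
  have h_mod_eq: "x mod n = y mod n" if "h (x mod n) = h (y mod n)" "n > 0" for x y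
    using h_eq[OF that(1)] that(2) by simp
  have inj: "inj_on (\<phi> t) {..<2 * r}" for t
  proof (rule inj_onI)
    fix i j assume ij: "i \<in> {..<2 * r}" "j \<in> {..<2 * r}" "\<phi> t i = \<phi> t j"
    then have "(t + pos i) mod n = (t + pos j) mod n"
      using h_mod_eq unfolding \<phi>_def n_def by auto
    then have "t + pos i = t + pos j"
      by (rule mod_eq_imp_eq_int) (use pos_bound[of i] pos_bound[of j] ij in \<open>auto simp: n_def\<close>)
    then show "i = j"
      using pos_eq by simp
  qed
  have range: "\<phi> t j \<in> W" if "r > 0" for t j
    using h that unfolding \<phi>_def bij_betw_def n_def by auto
  show ?thesis
  proof (rule decomposable_family[where \<phi> = \<phi> and I = "{0..<int r}"])
    fix t assume "t \<in> {0..<int r}"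
    then have "r > 0"
      by auto
    show "inj_on (\<phi> t) {..<2 * r}"
      by (rule inj)
    then have path: "is_path (2 * r) (map (\<phi> t) [0..<2 * r])"
      unfolding is_path_def by (simp add: distinct_map atLeast0LessThan)
    then have "card (set (map (\<phi> t) [0..<2 * r])) = card W"
      using distinct_card unfolding is_path_def card(2) by metis
    moreover have "set (map (\<phi> t) [0..<2 * r]) \<subseteq> W"
      using range[OF \<open>r > 0\<close>] by auto
    ultimately show "Q (map (\<phi> t) [0..<2 * r])"
      using Q[OF path] card(1) card_subset_eq by metis
  next
    fix t t' j j'
    assume t: "t \<in> {0..<int r}" "t' \<in> {0..<int r}" and
      eq: "{\<phi> t j, \<phi> t (Suc j)} = {\<phi> t' j', \<phi> t' (Suc j')}"
    have "n > 0"
      using t unfolding n_def by auto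
    \<comment> \<open>The sum of the two residues is independent of the order of the ends, hence a
      function of the undirected edge.\<close>
    then have "((t + pos j) mod n + (t + pos (Suc j)) mod n) mod n =
        ((t' + pos j') mod n + (t' + pos (Suc j')) mod n) mod n"
      using eq h_mod_eq unfolding \<phi>_def doubleton_eq_iff by (metis add.commute)
    then have "(2 * t + (pos j + pos (Suc j))) mod n = (2 * t' + (pos j' + pos (Suc j'))) mod n"
      unfolding mod_add_eq by (simp add: algebra_simps)
    \<comment> \<open>Both sides lie between 0 and \<open>n - 1\<close>, so congruence becomes
      equality; halving then gives \<open>t = t'\<close>.\<close>
    then have "2 * t + (pos j + pos (Suc j)) = 2 * t' + (pos j' + pos (Suc j'))"
      by (rule mod_eq_imp_eq_int) (use t in \<open>auto simp: pos_sum n_def\<close>)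
    then show "t = t'"
      by (simp add: pos_sum split: if_splits; presburger)
  next
    fix e
    show "e \<in> complete_edges W \<longleftrightarrow>
      (\<exists>t\<in>{0..<int r}. \<exists>j. Suc j < 2 * r \<and> e = {\<phi> t j, \<phi> t (Suc j)})"
    proof
      assume "\<exists>t\<in>{0..<int r}. \<exists>j. Suc j < 2 * r \<and> e = {\<phi> t j, \<phi> t (Suc j)}"
      then obtain t j where tj: "t \<in> {0..<int r}" "Suc j < 2 * r" "e = {\<phi> t j, \<phi> t (Suc j)}"
        by blast
      then have "\<phi> t j \<noteq> \<phi> t (Suc j)"
        using inj_on_eq_iff[OF inj, of j "Suc j" t] by simp
      moreover have "\<phi> t j \<in> W" "\<phi> t (Suc j) \<in> W"
        using range tj(2) by simp_all
      ultimately show "e \<in> complete_edges W"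
        using tj(3) unfolding complete_edges_def by blast
    next
      assume "e \<in> complete_edges W"
      then obtain u v where uv: "u \<in> W" "v \<in> W" "u \<noteq> v" "e = {u, v}"
        unfolding complete_edges_def by blast
      have W: "W = h ` {0..<n}"
        using h unfolding bij_betw_def by simp
      obtain a where a: "0 \<le> a" "a < n" "u = h a"
        using uv(1) unfolding W by auto
      obtain b where b: "0 \<le> b" "b < n" "v = h b"
        using uv(2) unfolding W by auto
      note ab = a b
      \<comment> \<open>The residue of the sum labels the edge: its half names the zigzag, its
        parity the kind of step in it.\<close>
      define \<sigma> where "\<sigma> = (a + b) mod n"
      define t where "t = \<sigma> div 2"
      define \<epsilon> where "\<epsilon> = \<sigma> mod 2"
      have \<sigma>: "\<sigma> = 2 * t + \<epsilon>" "0 \<le> \<sigma>" "\<sigma> < n"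
        using ab unfolding \<sigma>_def t_def \<epsilon>_def by auto
      have t: "t \<in> {0..<int r}"
        using \<sigma>(2,3) unfolding t_def n_def by auto
      define d where "d = (a - t) mod n"
      have d: "0 \<le> d" "d < n"
        using ab unfolding d_def by auto
      \<comment> \<open>This inverts \<open>pos\<close>: residues 1 to \<open>r\<close> stand at the
        odd places, 0 at the start, and each larger \<open>d\<close> represents
        \<open>d - n\<close>, at an even place.\<close>
      define j where "j = nat (if 1 \<le> d \<and> d \<le> int r then 2 * d - 1 else if d = 0 then 0 else 2 * (n - d))"
      have j: "j < 2 * r" "pos j = (if d \<le> int r then d else d - n)"
        using d unfolding j_def pos_def n_def by (auto simp: nat_less_iff even_nat_iff nat_diff_distrib)
      then have pos_j: "pos j mod n = d"
        using d by simp
      have \<phi>_j: "\<phi> t j = u"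
      proof -
        have "(t + pos j) mod n = (t + (a - t)) mod n"
          by (metis d_def mod_add_right_eq pos_j)
        then show ?thesis
          using ab unfolding \<phi>_def by simp
      qed
      have \<phi>_i: "\<phi> t i = v" if "(pos i + pos j) mod n = \<epsilon> mod n" for i
      proof -
        have "(t + pos i) mod n = ((t + \<epsilon>) - pos j) mod n"
          using that by (metis (no_types, opaque_lifting) add.assoc add_diff_cancel_right' mod_add_right_eq mod_diff_left_eq)
        also have "\<dots> = ((t + \<epsilon>) - (a - t)) mod n"
          by (metis d_def mod_diff_right_eq pos_j)
        also have "\<dots> = (\<sigma> - a) mod n"
          using \<sigma>(1) by (simp add: algebra_simps)
        also have "\<dots> = b"
          using ab unfolding \<sigma>_def by (simp add: mod_diff_left_eq)
        finally show ?thesis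
          using ab unfolding \<phi>_def by simp
      qed
      have \<epsilon>: "\<epsilon> = 0 \<or> \<epsilon> = 1"
        unfolding \<epsilon>_def by auto
      \<comment> \<open>Otherwise place \<open>j\<close> would hold \<open>v\<close> as well as
        \<open>u\<close>.\<close>
      have not_self: "(pos j + pos j) mod n \<noteq> \<epsilon> mod n"
        using \<phi>_i[of j] \<phi>_j uv(3) by auto
      show "\<exists>t\<in>{0..<int r}. \<exists>j. Suc j < 2 * r \<and> e = {\<phi> t j, \<phi> t (Suc j)}"
      \<comment> \<open>The parities decide whether \<open>v\<close> comes just after or just before
        \<open>u\<close>. If that neighbour fell off an end of the path, twice \<open>pos j\<close>
        would have residue \<open>\<epsilon>\<close>, contrary to \<open>not_self\<close>.\<close>
      proof (cases "(\<epsilon> = 1) = even j")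
        case True
        then have "pos (Suc j) + pos j = \<epsilon>"
          using \<epsilon> pos_sum[of j] by auto
        moreover have "Suc j < 2 * r"
        proof (rule ccontr)
          assume "\<not> Suc j < 2 * r"
          then have "Suc j = 2 * r"
            using j(1) by simp
          moreover from this have "odd j"
            by presburger
          ultimately have "pos j = int r" "\<epsilon> = 0"
            using True \<epsilon> unfolding pos_def by auto
          then show False
            using not_self unfolding n_def by simp
        qed
        ultimately show ?thesis
          using t \<phi>_i[of "Suc j"] \<phi>_j uv(4) by blast
      next
        case False
        have "j \<noteq> 0"
        proof
          assume "j = 0"
          then have "pos j = 0" "\<epsilon> = 0"
            using False \<epsilon> unfolding pos_def by auto
          then show False
            using not_self by simp
        qed
        then obtain i where i: "j = Suc i"
          by (cases j) auto
        then have "pos i + pos j = \<epsilon>"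
          using False \<epsilon> pos_sum[of i] by auto
        then show ?thesis
          using t \<phi>_i[of i] \<phi>_j uv(4) i j(1) by blast
      qed
    qed
  qed
qed

text \<open>The paths are the translates of \<open>\<alpha> 0\<close>, \<open>\<beta> 0\<close>,
  \<open>\<alpha> 1\<close>, \<open>\<beta> (-1)\<close>, \<open>\<alpha> 2\<close>, ..., with
  indices modulo \<open>M\<close>. The hypothesis on \<open>Q\<close> lists what all translates
  share: a vertex of index 0 on at least one side and one of nonzero index on both.\<close>

lemma decomposable_biclique:
  fixes \<alpha> \<beta> :: "int \<Rightarrow> 'a"
  assumes r: "r \<ge> 2" and M: "M = 2 * int r - 1"
    and inj: "inj \<alpha>" "inj \<beta>" "\<And>x y. \<alpha> x \<noteq> \<beta> y"
    and Q: "\<And>p x y. \<lbrakk>\<alpha> 0 \<in> set p \<or> \<beta> 0 \<in> set p; x \<noteq> 0; \<alpha> x \<in> set p; y \<noteq> 0; \<beta> y \<in> set p;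
      set p \<subseteq> \<alpha> ` {0..<M} \<union> \<beta> ` {0..<M}\<rbrakk> \<Longrightarrow> Q p"
  shows "decomposable (2 * r) Q {{\<alpha> x, \<beta> y} | x y. x \<in> {0..<M} \<and> y \<in> {0..<M}}"
proof -
  \<comment> \<open>The \<open>j\<close>-th edge of each path consists of vertices with difference \<open>j\<close> modulo \<open>M\<close>.\<close>
  define \<phi> where "\<phi> t j = (if even j then \<alpha> ((t + int (j div 2)) mod M)
    else \<beta> ((t - int (j div 2)) mod M))" for t j
  have M_pos: "M > 1"
    using r M by simp
  have edge: "{\<phi> t j, \<phi> t (Suc j)} = {\<alpha> ((t + int (Suc j div 2)) mod M), \<beta> ((t - int (j div 2)) mod M)}"
    for t j
    unfolding \<phi>_def by (cases "even j") auto
  show ?thesis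
  proof (rule decomposable_family[where \<phi> = \<phi> and I = "{0..<M}"])
    fix t assume t: "t \<in> {0..<M}"
    show "inj_on (\<phi> t) {..<2 * r}"
    proof (rule inj_onI)
      fix i j assume ij: "i \<in> {..<2 * r}" "j \<in> {..<2 * r}" "\<phi> t i = \<phi> t j"
      have parity: "even i = even j"
        using ij(3) inj(3) unfolding \<phi>_def by (metis (full_types))
      have "(t + int (i div 2)) mod M = (t + int (j div 2)) mod M \<or>
        (t - int (i div 2)) mod M = (t - int (j div 2)) mod M"
        using ij(3) parity inj(1,2) unfolding \<phi>_def by (auto dest: injD split: if_splits)
      then have "i div 2 = j div 2"
      proof
        assume "(t + int (i div 2)) mod M = (t + int (j div 2)) mod M"
        then have "t + int (i div 2) = t + int (j div 2)"
          by (rule mod_eq_imp_eq_int) (use ij r in \<open>auto simp: M\<close>)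
        then show ?thesis
          by simp
      next
        assume "(t - int (i div 2)) mod M = (t - int (j div 2)) mod M"
        then have "t - int (i div 2) = t - int (j div 2)"
          by (rule mod_eq_imp_eq_int) (use ij r in \<open>auto simp: M\<close>)
        then show ?thesis
          by simp
      qed
      then show "i = j"
        using parity by presburger
    qed
    let ?p = "map (\<phi> t) [0..<2 * r]"
    have mem: "\<phi> t j \<in> set ?p" if "j < 2 * r" for j
      using that by simp
    \<comment> \<open>Two neighbouring residues are not both 0 because \<open>M > 1\<close>; each
      side of a path contains such a pair.\<close>
    have nonzero: "t mod M \<noteq> 0 \<or> (t + 1) mod M \<noteq> 0" "t mod M \<noteq> 0 \<or> (t - 1) mod M \<noteq> 0"
    proof -
      have "t = 0" if "t mod M = 0"
        using t that by simp
      moreover have "(-1) mod M = M - 1"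
        using M_pos by (simp add: zmod_minus1)
      ultimately show "t mod M \<noteq> 0 \<or> (t + 1) mod M \<noteq> 0" "t mod M \<noteq> 0 \<or> (t - 1) mod M \<noteq> 0"
        using M_pos by auto
    qed
    have "\<phi> t 0 = \<alpha> (t mod M)" "\<phi> t 2 = \<alpha> ((t + 1) mod M)"
      "\<phi> t 1 = \<beta> (t mod M)" "\<phi> t 3 = \<beta> ((t - 1) mod M)"
      unfolding \<phi>_def by simp_all
    then obtain x y where xy: "x \<noteq> 0" "\<alpha> x \<in> set ?p" "y \<noteq> 0" "\<beta> y \<in> set ?p"
      using nonzero mem[of 0] mem[of 1] mem[of 2] mem[of 3] r by force
    \<comment> \<open>The \<open>\<beta>\<close> indices run down from \<open>t\<close> through
      \<open>r\<close> residues and reach 0 if \<open>t < r\<close>. Otherwise the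
      \<open>\<alpha>\<close> indices, running up from \<open>t\<close>, reach \<open>M\<close>
      within \<open>r\<close> residues.\<close>
    have zero: "\<alpha> 0 \<in> set ?p \<or> \<beta> 0 \<in> set ?p"
    proof (cases "t < int r")
      case True
      then have "\<phi> t (2 * nat t + 1) = \<beta> 0"
        using t unfolding \<phi>_def by simp
      moreover have "2 * nat t + 1 < 2 * r"
        using True t by auto
      ultimately show ?thesis
        using mem by metis
    next
      case False
      then have "\<phi> t (2 * nat (M - t)) = \<alpha> 0"
        using t unfolding \<phi>_def by simp
      moreover have "2 * nat (M - t) < 2 * r"
        using False t M by auto
      ultimately show ?thesis
        using mem by metis
    qed
    have "set ?p \<subseteq> \<alpha> ` {0..<M} \<union> \<beta> ` {0..<M}"
      using M_pos unfolding \<phi>_def by auto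
    then show "Q ?p"
      using Q[OF zero xy] by blast
  next
    fix t t' j j'
    assume t: "t \<in> {0..<M}" "t' \<in> {0..<M}" and j: "Suc j < 2 * r" "Suc j' < 2 * r"
      and eq: "{\<phi> t j, \<phi> t (Suc j)} = {\<phi> t' j', \<phi> t' (Suc j')}"
    have x: "(t + int (Suc j div 2)) mod M = (t' + int (Suc j' div 2)) mod M"
      and y: "(t - int (j div 2)) mod M = (t' - int (j' div 2)) mod M"
      using eq inj unfolding edge by (auto simp: doubleton_eq_iff dest: injD)
    \<comment> \<open>The difference of the two indices returns the place \<open>j\<close> of the
      edge, after which either index returns \<open>t\<close>.\<close>
    have split: "(t + int (Suc j div 2)) - (t - int (j div 2)) = int j" for t j
      by (cases "even j") (auto elim!: evenE oddE)
    have "int j mod M = int j' mod M"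
      using mod_diff_cong[OF x y] unfolding split .
    then have "int j = int j'"
      by (rule mod_eq_imp_eq_int) (use j in \<open>auto simp: M\<close>)
    then have "t mod M = t' mod M"
      using mod_add_cong[OF y refl[of "int (j div 2) mod M"]] by simp
    then show "t = t'"
      using t by simp
  next
    fix e
    show "e \<in> {{\<alpha> x, \<beta> y} | x y. x \<in> {0..<M} \<and> y \<in> {0..<M}} \<longleftrightarrow>
      (\<exists>t\<in>{0..<M}. \<exists>j. Suc j < 2 * r \<and> e = {\<phi> t j, \<phi> t (Suc j)})"
    proof
      assume "\<exists>t\<in>{0..<M}. \<exists>j. Suc j < 2 * r \<and> e = {\<phi> t j, \<phi> t (Suc j)}"
      then show "e \<in> {{\<alpha> x, \<beta> y} | x y. x \<in> {0..<M} \<and> y \<in> {0..<M}}"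
        unfolding edge using M_pos by fastforce
    next
      assume "e \<in> {{\<alpha> x, \<beta> y} | x y. x \<in> {0..<M} \<and> y \<in> {0..<M}}"
      then obtain x y where xy: "x \<in> {0..<M}" "y \<in> {0..<M}" "e = {\<alpha> x, \<beta> y}"
        by blast
      define j where "j = nat ((x - y) mod M)"
      define t where "t = (x - int (Suc j div 2)) mod M"
      have j: "int j = (x - y) mod M" "Suc j < 2 * r"
        using M_pos M pos_mod_bound[of M "x - y"] pos_mod_sign[of M "x - y"] unfolding j_def by linarith+
      have t: "t \<in> {0..<M}"
        using M_pos unfolding t_def by simp
      have "(t + int (Suc j div 2)) mod M = x"
        using xy(1) unfolding t_def by (simp add: mod_add_left_eq)
      moreover have "(t - int (j div 2)) mod M = y"
      proof -
        have "int (Suc j div 2) + int (j div 2) = int j"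
          by presburger
        then have "(t - int (j div 2)) mod M = (x - int j) mod M"
          unfolding t_def by (simp add: mod_diff_left_eq algebra_simps)
        also have "\<dots> = y"
          using xy(2) unfolding j(1) by (simp add: mod_diff_right_eq)
        finally show ?thesis .
      qed
      ultimately have "e = {\<phi> t j, \<phi> t (Suc j)}"
        unfolding edge xy(3) by simp
      then show "\<exists>t\<in>{0..<M}. \<exists>j. Suc j < 2 * r \<and> e = {\<phi> t j, \<phi> t (Suc j)}"
        using t j(2) by blast
    qed
  qed
qed

section \<open>Completion of a critical packing to a path system\<close>

text \<open>Criticality with parameter \<open>k - 1\<close> means that \<open>f\<close> uses colours
  below \<open>k\<close> and that \<open>k - 1\<close> colours never suffice. The modified colouring
  \<open>F\<close> shows that \<open>k\<close> colours still suffice after completion, and a copy of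
  \<open>B\<close> among the lifts preserves the lower bound.\<close>

lemma chromatic_of_critical:
  fixes U :: "'a set"
  assumes crit: "critical (2 * r) (k - 1) U B f" and r: "r \<ge> 2" and k: "k \<ge> 2"
  shows "\<exists>n (V :: ('a \<times> int) option set) B'. path_system (2 * r) n V B' \<and> chromatic k V B'"
proof -
  have finU: "finite U" and pack: "packing (2 * r) U B" and f: "\<And>u. u \<in> U \<Longrightarrow> f u < k"
    and nm: "\<And>g. \<forall>u\<in>U. g u < k - 1 \<Longrightarrow> \<exists>p\<in>B. monochromatic g p"
    and alt: "\<And>p. p \<in> B \<Longrightarrow> f (p ! 0) = f (p ! 2) \<and> f (p ! 1) \<noteq> f (p ! 0) \<and> f (p ! 3) \<noteq> f (p ! 0)"
    using crit k unfolding critical_def by auto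
  have B: "length p = 2 * r" "distinct p" "set p \<subseteq> U" if "p \<in> B" for p
    using pack that unfolding packing_def is_path_def by auto
  have nth_U: "p ! j \<in> U" if "p \<in> B" "j < 2 * r" for p j
    using B[OF that(1)] that(2) by (auto simp: subset_iff)
  have "U \<noteq> {}"
  proof
    assume "U = {}"
    \<comment> \<open>The bound on \<open>g\<close> is vacuous on the empty set, so criticality
      would give a path without vertices.\<close>
    then obtain p where "p \<in> B"
      using nm[of "\<lambda>_. 0"] by auto
    then show False
      using B[of p] \<open>U = {}\<close> r by auto
  qed
  define M where "M = 2 * int r - 1"
  define Z where "Z = {0..<M}"
  have Z: "0 \<in> Z" "1 \<in> Z" "2 \<in> Z" "finite Z" "card Z = 2 * r - 1"
    using r unfolding Z_def M_def by (auto simp: nat_diff_distrib nat_mult_distrib)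
  define W where "W u = insert None ((\<lambda>x. Some (u, x)) ` Z)" for u :: 'a
  define V where "V = insert None (Some ` (U \<times> Z))"
  \<comment> \<open>The exceptional vertex of \<open>u\<close> gets whichever of 0 and 1 differs
    from \<open>f u\<close>, or 0 if both do; these are legitimate colours since
    \<open>k \<ge> 2\<close>.\<close>
  define F where "F = case_option 0 (\<lambda>(u, x). if x = (0 :: int) then if f u = 0 then 1 else 0 else f u)"
  have F_less: "F v < k" if "v \<in> V" for v
    using that f k unfolding V_def F_def by auto
  have F0: "F (Some (u, 0)) \<noteq> f u" and F1: "x \<noteq> 0 \<Longrightarrow> F (Some (u, x)) = f u" for u x
    unfolding F_def by auto
  \<comment> \<open>The permutation moves the exceptional position 0, so that no lift has exceptional vertices at
    both of the positions 0, 2 or both of 1, 3; it fixes 1, so that the vertices \<open>Some (u, 1)\<close> carry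
    a copy of \<open>B\<close>.\<close>
  define \<tau> :: "int \<Rightarrow> int" where "\<tau> = transpose 0 2"
  have \<tau>: "\<tau> (\<tau> x) = x" "\<tau> x \<in> Z \<longleftrightarrow> x \<in> Z" "\<tau> 1 = 1" "x = 0 \<Longrightarrow> \<tau> x \<noteq> 0" for x
    using Z unfolding \<tau>_def transpose_def by auto
  \<comment> \<open>Consecutive positions use one of \<open>s\<close>, \<open>t\<close> each, up to
    the bijection \<open>\<tau>\<close> of \<open>Z\<close>. Hence, as \<open>s\<close> and
    \<open>t\<close> range over \<open>Z\<close>, the lifts of one edge meet every edge between its
    two groups exactly once.\<close>
  define w where "w s t j = (let z = if even j then s else t in if j < 2 then z else \<tau> z)"
    for s t and j :: nat
  have w_Z: "w s t j \<in> Z" if "s \<in> Z" "t \<in> Z" for s t j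
    using that \<tau>(2) unfolding w_def Let_def by auto
  have w_inj: "s = s' \<and> t = t'" if "w s t j = w s' t' j" "w s t (Suc j) = w s' t' (Suc j)" for s t s' t' j
    using that \<tau>(1) unfolding w_def Let_def by (auto split: if_splits) metis+
  have w_surj: "\<exists>s\<in>Z. \<exists>t\<in>Z. w s t j = x \<and> w s t (Suc j) = y" if "x \<in> Z" "y \<in> Z" for x y j
  proof -
    have *: "\<exists>z\<in>Z. (if j < 2 then z else \<tau> z) = x" if "x \<in> Z" for x and j :: nat
      using that \<tau>(1,2) by (cases "j < 2") auto
    obtain a b where ab: "a \<in> Z" "(if j < 2 then a else \<tau> a) = x"
      "b \<in> Z" "(if Suc j < 2 then b else \<tau> b) = y"
      using *[OF \<open>x \<in> Z\<close>, of j] *[OF \<open>y \<in> Z\<close>, of "Suc j"] by blast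
    show ?thesis
    proof (cases "even j")
      case True
      then have "w a b j = x" "w a b (Suc j) = y"
        using ab unfolding w_def Let_def by (simp_all split: if_splits)
      then show ?thesis
        using ab by blast
    next
      case False
      then have "w b a j = x" "w b a (Suc j) = y"
        using ab unfolding w_def Let_def by (simp_all split: if_splits)
      then show ?thesis
        using ab by blast
    qed
  qed
  define lift where "lift = (\<lambda>(p, s, t). map (\<lambda>j. Some (p ! j :: 'a, w s t j)) [0..<2 * r])"
  define L where "L = lift ` (B \<times> Z \<times> Z)"
  define E where "E = (\<Union>p\<in>B. path_edges p)"
  have E_sub: "E \<subseteq> complete_edges U"
    using path_edges_subset_complete_edges B(2,3) unfolding E_def by blast
  have lift_edgeE: thesis if "e \<in> path_edges (lift (p, s, t))"
    "\<And>j. Suc j < 2 * r \<Longrightarrow> e = {Some (p ! j, w s t j), Some (p ! Suc j, w s t (Suc j))} \<Longrightarrow> thesis"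
    for e p s t thesis
    using that by (auto simp: lift_def elim!: path_edgesE)
  have L_path: "is_path (2 * r) q \<and> set q \<subseteq> V \<and> \<not> monochromatic F q" if "q \<in> L" for q
  proof -
    obtain p s t where p: "p \<in> B" and st: "s \<in> Z" "t \<in> Z" and q: "q = lift (p, s, t)"
      using \<open>q \<in> L\<close> unfolding L_def by blast
    have "inj_on (\<lambda>j. Some (p ! j, w s t j)) {..<2 * r}"
      using B[OF p] by (auto simp: inj_on_def nth_eq_iff_index_eq)
    then have "is_path (2 * r) q"
      unfolding is_path_def q lift_def by (simp add: distinct_map atLeast0LessThan)
    moreover have "set q \<subseteq> V"
      using nth_U[OF p] w_Z[OF st] unfolding q lift_def V_def by auto
    moreover have "\<not> monochromatic F q"
    proof -
      have mem: "Some (p ! j, w s t j) \<in> set q" if "j < 2 * r" for j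
        using that unfolding q lift_def by auto
      have "w s t 0 = s" "w s t 1 = t" "w s t 2 = \<tau> s" "w s t 3 = \<tau> t"
        unfolding w_def by simp_all
      then have mem': "Some (p ! 0, s) \<in> set q" "Some (p ! 2, \<tau> s) \<in> set q"
        "Some (p ! 1, t) \<in> set q" "Some (p ! 3, \<tau> t) \<in> set q"
        using mem[of 0] mem[of 1] mem[of 2] mem[of 3] r by simp_all
      \<comment> \<open>At most one of \<open>s\<close>, \<open>\<tau> s\<close> is 0, so position 0
        or 2 keeps the colour \<open>f (p ! 0)\<close>. In the same way position 1 or 3 keeps its
        colour, which is a different one.\<close>
      have "\<exists>v\<in>set q. F v = f (p ! 0)"
        using mem' F1[of s] F1[of "\<tau> s"] \<tau>(4)[of s] alt[OF p] by metis
      moreover have "\<exists>v\<in>set q. F v \<noteq> f (p ! 0)"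
        using mem' F1[of t] F1[of "\<tau> t"] \<tau>(4)[of t] alt[OF p] by metis
      ultimately show ?thesis
        by (metis not_monochromaticI)
    qed
    ultimately show ?thesis
      by blast
  qed
  have L_disj: "disjoint_family_on path_edges L"
    unfolding L_def
  proof (rule disjoint_family_on_imageI)
    fix a b e
    assume "a \<in> B \<times> Z \<times> Z" "b \<in> B \<times> Z \<times> Z" and e: "e \<in> path_edges (lift a)" "e \<in> path_edges (lift b)"
    then obtain p s t p' s' t' where ab: "a = (p, s, t)" "b = (p', s', t')" "p \<in> B" "p' \<in> B"
      by auto
    obtain j where j: "Suc j < 2 * r" "e = {Some (p ! j, w s t j), Some (p ! Suc j, w s t (Suc j))}"
      using e(1) unfolding ab(1) by (rule lift_edgeE)
    obtain i where i: "Suc i < 2 * r" "e = {Some (p' ! i, w s' t' i), Some (p' ! Suc i, w s' t' (Suc i))}"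
      using e(2) unfolding ab(2) by (rule lift_edgeE)
    \<comment> \<open>Projecting a lifted edge to \<open>U\<close> gives an edge of the packing,
      which fixes \<open>p\<close> and the position; the second coordinates then fix
      \<open>s\<close> and \<open>t\<close>.\<close>
    have "(fst \<circ> the) ` e = {p ! j, p ! Suc j}" "(fst \<circ> the) ` e = {p' ! i, p' ! Suc i}"
      by (simp add: j(2)) (simp add: i(2))
    then have eq: "{p ! j, p ! Suc j} = {p' ! i, p' ! Suc i}"
      by simp
    have "{p ! j, p ! Suc j} \<in> path_edges p" "{p ! j, p ! Suc j} \<in> path_edges p'"
      using j(1) i(1) eq B(1) ab by (auto intro: path_edgesI)
    then have p: "p = p'"
      using pack ab unfolding packing_def by (metis disjoint_family_onE)
    then have ij: "i = j"
      using path_edges_nth_cong[OF B(2)[OF ab(3)]] eq i(1) j(1) B(1)[OF ab(3)] by simp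
    have "p ! j \<noteq> p ! Suc j"
      using B[OF ab(3)] j(1) by (simp add: nth_eq_iff_index_eq)
    then have "w s t j = w s' t' j" "w s t (Suc j) = w s' t' (Suc j)"
      using j(2) i(2) unfolding p ij by (auto simp: doubleton_eq_iff)
    then show "lift a = lift b"
      using w_inj p ab by metis
  qed
  have L_edges: "(\<Union>q\<in>L. path_edges q) = {{Some (a, x), Some (b, y)} | a b x y. {a, b} \<in> E \<and> x \<in> Z \<and> y \<in> Z}"
    (is "_ = ?E")
  proof (intro equalityI subsetI)
    fix e assume "e \<in> (\<Union>q\<in>L. path_edges q)"
    then obtain p s t where pst: "p \<in> B" "s \<in> Z" "t \<in> Z" "e \<in> path_edges (lift (p, s, t))"
      unfolding L_def by auto
    obtain j where j: "Suc j < 2 * r" "e = {Some (p ! j, w s t j), Some (p ! Suc j, w s t (Suc j))}"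
      using pst(4) by (rule lift_edgeE)
    have "{p ! j, p ! Suc j} \<in> E"
      using j(1) pst(1) B(1) path_edgesI[of j p] unfolding E_def by auto
    then show "e \<in> ?E"
      using j(2) w_Z pst by blast
  next
    have main: "{Some (p ! j, x), Some (p ! Suc j, y)} \<in> (\<Union>q\<in>L. path_edges q)"
      if "p \<in> B" "Suc j < 2 * r" "x \<in> Z" "y \<in> Z" for p j x y
    proof -
      obtain s t where st: "s \<in> Z" "t \<in> Z" "w s t j = x" "w s t (Suc j) = y"
        using w_surj \<open>x \<in> Z\<close> \<open>y \<in> Z\<close> by blast
      then have "{Some (p ! j, x), Some (p ! Suc j, y)} \<in> path_edges (lift (p, s, t))"
        using that(2) by (intro path_edgesI[of j]) (auto simp: lift_def)
      then show ?thesis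
        using that(1) st(1,2) unfolding L_def by blast
    qed
    fix e assume "e \<in> ?E"
    then obtain a b x y where e: "e = {Some (a, x), Some (b, y)}" "{a, b} \<in> E" "x \<in> Z" "y \<in> Z"
      by blast
    then obtain p j where p: "p \<in> B" "Suc j < 2 * r" "{a, b} = {p ! j, p ! Suc j}"
      using B(1) unfolding E_def by (auto elim!: path_edgesE)
    then consider "a = p ! j" "b = p ! Suc j" | "a = p ! Suc j" "b = p ! j"
      by (auto simp: doubleton_eq_iff)
    then show "e \<in> (\<Union>q\<in>L. path_edges q)"
    proof cases
      case 1
      then show ?thesis
        using main[OF p(1,2) e(3,4)] e(1) by simp
    next
      case 2
      then show ?thesis
        using main[OF p(1,2) e(4,3)] e(1) by (simp add: insert_commute)
    qed
  qed
  define N where "N = {(a, b). a \<in> U \<and> b \<in> U \<and> a \<noteq> b \<and> {a, b} \<notin> E}"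
  define K where "K = (\<lambda>(a, b). {{Some (a :: 'a, x), Some (b, y)} | x y. x \<in> Z \<and> y \<in> Z})"
  define \<D> where "\<D> = (\<lambda>u. complete_edges (W u)) ` U \<union> K ` N"
  let ?Q = "\<lambda>p. set p \<subseteq> V \<and> \<not> monochromatic F p"
  have complete_W: "e \<in> complete_edges (W u) \<longleftrightarrow>
    (\<exists>x\<in>Z. e = {None, Some (u, x)}) \<or> (\<exists>x\<in>Z. \<exists>y\<in>Z. x \<noteq> y \<and> e = {Some (u, x), Some (u, y)})" for e u
  proof
    assume "e \<in> complete_edges (W u)"
    then obtain a b where "a \<in> W u" "b \<in> W u" "a \<noteq> b" "e = {a, b}"
      unfolding complete_edges_def by blast
    then show "(\<exists>x\<in>Z. e = {None, Some (u, x)}) \<or> (\<exists>x\<in>Z. \<exists>y\<in>Z. x \<noteq> y \<and> e = {Some (u, x), Some (u, y)})"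
      unfolding W_def by (auto simp: insert_commute)
  qed (auto simp: complete_edges_def W_def)
  have dec: "decomposable (2 * r) ?Q (\<Union>\<D>)"
  proof (rule decomposable_Union)
    fix D assume "D \<in> \<D>"
    then consider (group) u where "u \<in> U" "D = complete_edges (W u)"
      | (pair) a b where "(a, b) \<in> N" "D = K (a, b)"
      unfolding \<D>_def by auto
    then show "decomposable (2 * r) ?Q D"
    proof cases
      case group
      have W: "finite (W u)" "card (W u) = 2 * r"
        using Z r unfolding W_def by (auto simp: card_insert_if card_image inj_on_def)
      have Q: "?Q p" if "set p = W u" for p
      proof
        show "set p \<subseteq> V"
          using that group(1) unfolding W_def V_def by auto
        show "\<not> monochromatic F p"
          by (rule not_monochromaticI[of "Some (u, 0)" _ "Some (u, 1)"])
            (use Z that F0[of u] F1[of 1 u] in \<open>auto simp: W_def\<close>)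
      qed
      show ?thesis
        unfolding group(2) by (rule decomposable_complete_edges[OF W Q])
    next
      case pair
      have ab: "a \<in> U" "b \<in> U" "a \<noteq> b"
        using pair(1) unfolding N_def by auto
      have "decomposable (2 * r) ?Q {{Some (a, x), Some (b, y)} | x y. x \<in> {0..<M} \<and> y \<in> {0..<M}}"
      proof (rule decomposable_biclique[OF r M_def])
        fix p x y
        assume *: "Some (a, 0) \<in> set p \<or> Some (b, 0) \<in> set p" "x \<noteq> 0" "Some (a, x) \<in> set p"
          "y \<noteq> 0" "Some (b, y) \<in> set p"
          "set p \<subseteq> (\<lambda>x. Some (a, x)) ` {0..<M} \<union> (\<lambda>x. Some (b, x)) ` {0..<M}"
        have "set p \<subseteq> V"
          using *(6) ab unfolding V_def Z_def by auto
        moreover have "\<not> monochromatic F p"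
        proof
          assume "monochromatic F p"
          then obtain c where c: "\<And>v. v \<in> set p \<Longrightarrow> F v = c"
            unfolding monochromatic_def by blast
          \<comment> \<open>The vertices of nonzero index force \<open>f a = c = f b\<close>, but
            the path also contains an exceptional vertex of \<open>a\<close> or \<open>b\<close>,
            whose colour differs.\<close>
          have "f a = c" "f b = c"
            using c[OF *(3)] c[OF *(5)] F1 *(2,4) by auto
          then show False
            using *(1) c F0 by metis
        qed
        ultimately show "?Q p" ..
      qed (use ab in \<open>auto simp: inj_def\<close>)
      then show ?thesis
        unfolding pair(2) K_def Z_def by simp
    qed
  next
    have group_group: "u = v" if "e \<in> complete_edges (W u)" "e \<in> complete_edges (W v)" for e u v
    proof -
      have "\<exists>x. Some (u, x) \<in> e"
        using that(1) unfolding complete_W by blast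
      moreover have "e \<subseteq> W v"
        using that(2) unfolding complete_edges_def by blast
      ultimately show ?thesis
        unfolding W_def by blast
    qed
    have group_pair: False if "e \<in> complete_edges (W u)" "e \<in> K (a, b)" "(a, b) \<in> N" for e u a b
    proof -
      have "\<exists>x y. Some (a, x) \<in> e \<and> Some (b, y) \<in> e"
        using that(2) unfolding K_def by blast
      moreover have "e \<subseteq> W u"
        using that(1) unfolding complete_edges_def by blast
      ultimately have "a = u" "b = u"
        unfolding W_def by blast+
      then show False
        using that(3) unfolding N_def by blast
    qed
    have pair_pair: "K (a, b) = K (c, d)" if "e \<in> K (a, b)" "e \<in> K (c, d)" for e a b c d
    proof -
      have proj: "(fst \<circ> the) ` e = {a, b}" if "e \<in> K (a, b)" for a b
        using that unfolding K_def by auto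
      have "{a, b} = {c, d}"
        using proj[OF that(1)] proj[OF that(2)] by simp
      moreover have "K (a, b) \<subseteq> K (b, a)" for a b
        unfolding K_def by (auto simp: insert_commute)
      ultimately show ?thesis
        unfolding doubleton_eq_iff by (auto intro: equalityI)
    qed
    show "disjoint \<D>"
      unfolding disjoint_def
    proof (intro ballI impI)
      fix D D' assume D: "D \<in> \<D>" "D' \<in> \<D>" "D \<noteq> D'"
      have "D = D'" if "e \<in> D" "e \<in> D'" for e
        using D(1,2) that unfolding \<D>_def
        by (elim UnE imageE) (use group_group group_pair pair_pair in \<open>(metis surj_pair)+\<close>)
      then show "D \<inter> D' = {}"
        using D(3) by blast
    qed
  qed
  have disj: "\<Union>\<D> \<inter> (\<Union>q\<in>L. path_edges q) = {}"
  proof -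
    have "{a} \<notin> E" for a
      using E_sub unfolding complete_edges_def by (auto simp: doubleton_eq_iff)
    then have not_group: "e \<notin> complete_edges (W u)" if "e \<in> ?E" for e u
      using that unfolding complete_W by (auto simp: doubleton_eq_iff)
    have not_pair: "e \<notin> K (a, b)" if "e \<in> ?E" "(a, b) \<in> N" for e a b
    proof
      assume "e \<in> K (a, b)"
      then have "(fst \<circ> the) ` e = {a, b}"
        unfolding K_def by auto
      moreover have "(fst \<circ> the) ` e \<in> E"
        using that(1) by auto
      ultimately show False
        using that(2) unfolding N_def by simp
    qed
    have "e \<notin> D" if "e \<in> ?E" "D \<in> \<D>" for e D
      using that(2) not_group[OF that(1)] not_pair[OF that(1)] unfolding \<D>_def by auto
    then show ?thesis
      unfolding L_edges by blast
  qed
  have "\<exists>B'. L \<subseteq> B' \<and> (\<forall>p\<in>B'. is_path (2 * r) p \<and> ?Q p) \<and> disjoint_family_on path_edges B' \<and>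
    (\<Union>p\<in>B'. path_edges p) = \<Union>\<D> \<union> (\<Union>q\<in>L. path_edges q)"
    by (rule decomposable_extend[OF dec L_path L_disj disj])
  then obtain B' where B': "L \<subseteq> B'" "\<forall>p\<in>B'. is_path (2 * r) p \<and> ?Q p"
    "disjoint_family_on path_edges B'" "(\<Union>p\<in>B'. path_edges p) = \<Union>\<D> \<union> (\<Union>q\<in>L. path_edges q)"
    by metis
  have "(\<Union>p\<in>B'. path_edges p) = complete_edges V"
  proof
    show "(\<Union>p\<in>B'. path_edges p) \<subseteq> complete_edges V"
    proof (rule UN_least)
      fix p assume "p \<in> B'"
      then show "path_edges p \<subseteq> complete_edges V"
        using B'(2) unfolding is_path_def by (intro path_edges_subset_complete_edges) auto
    qed
  next
    have pair: "{Some (a, x), Some (b, y)} \<in> \<Union>\<D> \<union> ?E"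
      if "a \<in> U" "x \<in> Z" "b \<in> U" "y \<in> Z" "(a, x) \<noteq> (b, y)" for a b x y
    proof -
      consider "a = b" | "a \<noteq> b" "{a, b} \<in> E" | "(a, b) \<in> N"
        using \<open>a \<in> U\<close> \<open>b \<in> U\<close> unfolding N_def by blast
      then show ?thesis
      proof cases
        case 1
        then have "{Some (a, x), Some (b, y)} \<in> complete_edges (W a)"
          using that unfolding complete_W by blast
        then show ?thesis
          using that(1) unfolding \<D>_def by blast
      next
        case 2
        then show ?thesis
          using that by blast
      next
        case 3
        have "{Some (a, x), Some (b, y)} \<in> K (a, b)"
          using that unfolding K_def by blast
        then show ?thesis
          using 3 unfolding \<D>_def by blast
      qed
    qed
    have infinity: "{None, Some (a, x)} \<in> \<Union>\<D>" if "a \<in> U" "x \<in> Z" for a x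
    proof -
      have "{None, Some (a, x)} \<in> complete_edges (W a)"
        using that unfolding complete_W by blast
      then show ?thesis
        using that(1) unfolding \<D>_def by blast
    qed
    show "complete_edges V \<subseteq> (\<Union>p\<in>B'. path_edges p)"
    proof
      fix e assume "e \<in> complete_edges V"
      then obtain u v where uv: "u \<in> V" "v \<in> V" "u \<noteq> v" "e = {u, v}"
        unfolding complete_edges_def by blast
      show "e \<in> (\<Union>p\<in>B'. path_edges p)"
        unfolding B'(4) L_edges
        using uv pair infinity unfolding V_def by (auto simp: insert_commute)
    qed
  qed
  moreover have "finite V" "card V > 1"
    using finU Z \<open>U \<noteq> {}\<close> unfolding V_def
    by (auto simp: card_insert_if card_image card_cartesian_product card_gt_0_iff)
  ultimately have "path_system (2 * r) (card V) V B'"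
    using B'(2,3) unfolding path_system_def by blast
  moreover have "chromatic k V B'"
  proof -
    have "set p \<subseteq> V \<and> p \<noteq> []" if "p \<in> B'" for p
      using bspec[OF B'(2) that] r unfolding is_path_def by auto
    note iff = colourable_iff[of B' V, OF this]
    have "colourable k V B'"
      using iff B'(2) F_less by blast
    moreover have "\<not> colourable (k - 1) V B'"
    proof
      assume "colourable (k - 1) V B'"
      then obtain g where g: "\<forall>v\<in>V. g v < k - 1" "\<forall>p\<in>B'. \<not> monochromatic g p"
        using iff by blast
      then have "\<forall>u\<in>U. (g \<circ> (\<lambda>u. Some (u, 1))) u < k - 1"
        using Z unfolding V_def by auto
      then obtain p where p: "p \<in> B" "monochromatic (g \<circ> (\<lambda>u. Some (u, 1))) p"
        using nm by blast
      \<comment> \<open>As \<open>\<tau>\<close> fixes 1, this lift stays at index 1 throughout and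
        is a verbatim copy of \<open>p\<close>.\<close>
      have "lift (p, 1, 1) = map (\<lambda>u. Some (u, 1)) p"
        using B(1)[OF p(1)] \<tau>(3) by (intro nth_equalityI) (auto simp: lift_def w_def Let_def)
      moreover have "lift (p, 1, 1) \<in> B'"
        using p(1) Z B'(1) unfolding L_def by blast
      ultimately show False
        using g(2) p(2) by (metis monochromatic_map)
    qed
    ultimately show ?thesis
      unfolding chromatic_def by blast
  qed
  ultimately show ?thesis
    by blast
qed

theorem corollary3p4:
  fixes m k :: nat
  assumes "even m" and "m \<ge> 4" and "k \<ge> 2"
  shows "\<exists>n (V :: nat set) B. path_system m n V B \<and> chromatic k V B"
proof -
  obtain r where r: "m = 2 * r" "r \<ge> 2"
    using assms(1,2) by (auto elim!: evenE)
  obtain U :: "nat set" and B f where "critical (2 * r) (k - 1) U B f"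
    using critical_exists[OF r(2)] by blast
  then obtain n and V :: "(nat \<times> int) option set" and B'
    where "path_system m n V B'" "chromatic k V B'"
    using chromatic_of_critical[OF _ r(2) assms(3)] r(1) by blast
  then show ?thesis
    using chromatic_path_system_nat assms(2) by (metis gr0I not_numeral_le_zero)
qed

end
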